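(* Let $k\ge 1$ and $0\le i\le k-1$ be integers. Then for every integer $n\ge 0$, $$\sum_{j=0}^{2k+1} P_k^i(n+j) = 4\,P_k^i(n+2k).$$
   Context: For integers $k\ge 1$ and $0\le i\le k-1$, the generalized Pell $(k,i)$-numbers $P_k^i(n)$, $n\ge 0$, are defined by $P_k^i(0)=P_k^i(1)=\cdots=P_k^i(i)=0$, $P_k^i(i+1)=P_k^i(i+2)=\cdots=P_k^i(k)=1$, and $P_k^i(n)=2P_k^i(n-1)+P_k^i(n-k-1)$ for $n\ge k+1$. *)

theory Defs
  imports Main
begin

text \<open>The generalized Pell \<open>(k,i)\<close>-numbers; \<open>gen_pell k i n\<close> is the paper's \<open>P\<^sub>k\<^sup>i(n)\<close>.
  It is meaningful only for \<open>k \<ge> 1\<close> and \<open>0 \<le> i \<le> k - 1\<close>. In the last branch \<open>n \<ge> k + 1\<close>,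
  so neither natural-number subtraction truncates.\<close>

fun gen_pell :: "nat \<Rightarrow> nat \<Rightarrow> nat \<Rightarrow> nat" where
  "gen_pell k i n =
    (if n \<le> i then 0
     else if n \<le> k then 1
     else 2 * gen_pell k i (n - 1) + gen_pell k i (n - k - 1))"

declare gen_pell.simps [simp del] \<comment> \<open>unconditional equation, would loop\<close>

end

theory Submission
  imports Defs
begin

text \<open>The recurrence gives \<open>P(m) + P(m + k + 1) = 2 (P(m + k + 1) - P(m + k))\<close>. Summed over
  \<open>n \<le> m \<le> n + k\<close>, the left side runs through all \<open>2k + 2\<close> terms and the right side telescopes to
  \<open>2 (P(n + 2k + 1) - P(n + k))\<close>, which is \<open>4 P(n + 2k)\<close> by the recurrence once more.\<close>

lemma gen_pell_rec:
  assumes "i \<le> k"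
  shows "gen_pell k i (m + k + 1) = 2 * gen_pell k i (m + k) + gen_pell k i m"
  using assms by (subst gen_pell.simps) simp

text \<open>Telescoping over \<open>nat\<close>: the subtracted end term
  \<open>2 * f (n + k)\<close> stands on the left, so no truncated subtraction arises. The induction
  step is \<open>rec\<close> at \<open>n + l\<close>.\<close>

lemma sum_shifted_pairs:
  fixes f :: "nat \<Rightarrow> nat"
  assumes rec: "\<And>m. f (m + k + 1) = 2 * f (m + k) + f m"
  shows "(\<Sum>j<l. f (n + j) + f (n + j + k + 1)) + 2 * f (n + k) = 2 * f (n + l + k)"
proof (induction l)
  case (Suc l)
  then show ?case using rec[of "n + l"] by (simp add: algebra_simps)
qed simp

theorem theorem7p4:
  fixes k i n :: nat
  assumes "k \<ge> 1" and "i \<le> k - 1"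
  shows "(\<Sum>j=0..2*k+1. gen_pell k i (n + j)) = 4 * gen_pell k i (n + 2*k)"
proof -
  let ?P = "gen_pell k i"
  have rec: "?P (m + k + 1) = 2 * ?P (m + k) + ?P m" for m
    using assms by (intro gen_pell_rec) simp
  \<comment> \<open>Only \<open>l = k + 1\<close> is needed, but a free \<open>l\<close> lets
    induction extend the second block while the first stays fixed.\<close>
  have "(\<Sum>j<(k + 1) + l. ?P (n + j)) =
      (\<Sum>j<k + 1. ?P (n + j)) + (\<Sum>j<l. ?P (n + j + k + 1))" for l
    by (induction l) (simp_all add: add_ac)
  moreover have "{0..2*k+1} = {..<(k + 1) + (k + 1)}" by auto
  ultimately have "(\<Sum>j=0..2*k+1. ?P (n + j)) =
      (\<Sum>j<k + 1. ?P (n + j)) + (\<Sum>j<k + 1. ?P (n + j + k + 1))"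
    by (simp only:)
  also have "\<dots> = (\<Sum>j<k + 1. ?P (n + j) + ?P (n + j + k + 1))"
    by (simp only: sum.distrib)
  finally have "(\<Sum>j=0..2*k+1. ?P (n + j)) + 2 * ?P (n + k) = 2 * ?P (n + k + k + 1)"
    using sum_shifted_pairs[of ?P k n "k + 1", OF rec] by (simp add: add_ac)
  \<comment> \<open>Doubling \<open>rec\<close> at \<open>n + k\<close> yields an extra
    \<open>2 * ?P (n + k)\<close>, which cancels the one on the left.\<close>
  then have "(\<Sum>j=0..2*k+1. ?P (n + j)) = 4 * ?P (n + k + k)"
    using rec[of "n + k"] by linarith
  then show ?thesis
    by (simp only: mult_2 add.assoc)
qed

end
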